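(* Let $f(t)=\sum_{j\ge 1} \frac{f_j}{j!} t^j$ be a formal power series with complex coefficients, $f(0)=0$ and $f'(0)\neq 0$, and let $\phi$ be the umbral operator associated with $f$, i.e. the linear operator on $\mathbb{C}[x]$ defined by $\phi x^n=\phi_n(x)$, where the polynomials $\phi_n$ are given by $e^{xf(t)}=\sum_{n\ge0}\phi_n(x)\frac{t^n}{n!}$. Let $Q=f^{-1}(D)$ be its delta operator. Then for every nonnegative integer $n$, \[ \phi\, \mathrm{x}^n=\sum_{k=0}^n \mathrm{x}^k\, B_{n,k}\big(f^{(1)}(Q),f^{(2)}(Q),\dots,f^{(n-k+1)}(Q)\big)\,\phi \] as operators on $\mathbb{C}[x]$.
   Context: $D$ denotes differentiation with respect to $x$ on $\mathbb{C}[x]$, and $\mathrm{x}$ denotes the operator of multiplication by $x$. $f^{-1}$ is the compositional inverse of $f$, and for a formal power series $g$, $g(D)$ (resp. $g(Q)$) is the operator obtained by substituting $D$ (resp. $Q$) into $g$; this is well defined on polynomials since $D$ is locally nilpotent and $Q=f^{-1}(D)$ has no constant term. $f^{(j)}$ denotes the $j$-th derivative of $f$ (a formal power series), so $f^{(j)}(Q)$ is a shift-invariant operator. $B_{n,k}$ is the partial (exponential) Bell polynomial, defined by $\frac{1}{k!}\big(\sum_{j\ge1} y_j \frac{t^j}{j!}\big)^k=\sum_{n\ge k} B_{n,k}(y_1,\dots,y_{n-k+1})\frac{t^n}{n!}$; its arguments here are commuting operators. *)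

theory Defs
  imports
    "HOL-Computational_Algebra.Computational_Algebra"
    "HOL-Library.Groups_Big_Fun"
begin

section \<open>The algebra of linear operators on complex polynomials\<close>

typedef poly_op = "{T :: complex poly \<Rightarrow> complex poly. Vector_Spaces.linear smult smult T}"
  morphisms op_apply Abs_poly_op
  by (rule exI[of _ "\<lambda>p. p"])
    (simp add: Vector_Spaces.linear_iff vector_space_def smult_add_right smult_add_left)

setup_lifting type_definition_poly_op

lemma vector_space_smult: "vector_space (smult :: complex \<Rightarrow> complex poly \<Rightarrow> complex poly)"
  by (simp add: vector_space_def smult_add_right smult_add_left)

lemma linear_smult_iff:
  "Vector_Spaces.linear (smult :: complex \<Rightarrow> _) smult T \<longleftrightarrow>
     (\<forall>p q. T (p + q) = T p + T q) \<and> (\<forall>c p. T (smult c p) = smult c (T p))"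
  by (simp add: Vector_Spaces.linear_iff vector_space_smult)

lemma smult_sum: "smult (c :: complex) (\<Sum>i\<in>A. h i) = (\<Sum>i\<in>A. smult c (h i))"
  by (induction A rule: infinite_finite_induct) (simp_all add: smult_add_right)

lemma op_apply_add [simp]: "op_apply T (p + q) = op_apply T p + op_apply T q"
  and op_apply_smult [simp]: "op_apply T (smult c p) = smult c (op_apply T p)"
  using op_apply[of T] by (simp_all add: linear_smult_iff)

lemma op_apply_0 [simp]: "op_apply T 0 = 0"
  using op_apply_smult[of T 0 0] by simp

lemma op_apply_sum: "op_apply T (\<Sum>i\<in>A. h i) = (\<Sum>i\<in>A. op_apply T (h i))"
  by (induction A rule: infinite_finite_induct) simp_all

lemma poly_op_eqI: "(\<And>p. op_apply S p = op_apply T p) \<Longrightarrow> S = T"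
  by (metis op_apply_inject ext)

text \<open>The product of operators is composition; real scalars act pointwise.\<close>

instantiation poly_op :: real_algebra_1
begin

lift_definition zero_poly_op :: poly_op is "\<lambda>p. 0" by (simp add: linear_smult_iff)
lift_definition one_poly_op :: poly_op is "\<lambda>p. p" by (simp add: linear_smult_iff)
lift_definition plus_poly_op :: "poly_op \<Rightarrow> poly_op \<Rightarrow> poly_op" is "\<lambda>S T p. S p + T p"
  by (simp add: linear_smult_iff smult_add_right)
lift_definition uminus_poly_op :: "poly_op \<Rightarrow> poly_op" is "\<lambda>T p. - T p"
  by (simp add: linear_smult_iff)
lift_definition minus_poly_op :: "poly_op \<Rightarrow> poly_op \<Rightarrow> poly_op" is "\<lambda>S T p. S p - T p"
  by (simp add: linear_smult_iff smult_diff_right)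
lift_definition times_poly_op :: "poly_op \<Rightarrow> poly_op \<Rightarrow> poly_op" is "\<lambda>S T p. S (T p)"
  by (simp add: linear_smult_iff)
lift_definition scaleR_poly_op :: "real \<Rightarrow> poly_op \<Rightarrow> poly_op"
  is "\<lambda>r T p. smult (complex_of_real r) (T p)"
  by (simp add: linear_smult_iff smult_add_right mult.commute)

instance
proof
  show "(0::poly_op) \<noteq> 1"
    by transfer (metis one_neq_zero)
qed (rule poly_op_eqI;
     simp add: zero_poly_op.rep_eq one_poly_op.rep_eq plus_poly_op.rep_eq uminus_poly_op.rep_eq
       minus_poly_op.rep_eq times_poly_op.rep_eq scaleR_poly_op.rep_eq
       smult_add_right smult_add_left)+

end

lift_definition op_X :: poly_op is "\<lambda>p. [:0, 1:] * p"
  by (simp add: linear_smult_iff algebra_simps)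

lift_definition op_D :: poly_op is "pderiv"
  by (simp add: linear_smult_iff pderiv_add pderiv_smult)


section \<open>Power series in a locally nilpotent operator\<close>

definition locally_nilpotent :: "poly_op \<Rightarrow> bool" where
  "locally_nilpotent T \<longleftrightarrow> (\<forall>p. \<exists>n. op_apply (T ^ n) p = 0)"

text \<open>The sum over \<open>n\<close> is pointwise finite, and the result linear, precisely because \<open>T\<close> is locally
  nilpotent (see \<open>op_apply_fps_op\<close>); the value is unspecified for other \<open>T\<close>.\<close>

definition fps_op :: "complex fps \<Rightarrow> poly_op \<Rightarrow> poly_op" where
  "fps_op g T = Abs_poly_op (\<lambda>p. \<Sum>n. smult (fps_nth g n) (op_apply (T ^ n) p))"

lemma op_apply_power_eq_0_mono:
  assumes "op_apply (T ^ N) p = 0" "N \<le> n"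
  shows "op_apply (T ^ n) p = 0"
proof -
  have "T ^ n = T ^ (n - N) * T ^ N"
    using assms(2) by (simp flip: power_add)
  then show ?thesis
    using assms(1) by (simp add: times_poly_op.rep_eq)
qed

lemma Sum_any_power_eq_sum:
  assumes "op_apply (T ^ N) p = 0"
  shows "(\<Sum>n. smult (fps_nth g n) (op_apply (T ^ n) p)) =
         (\<Sum>n<N. smult (fps_nth g n) (op_apply (T ^ n) p))"
proof (rule Sum_any.expand_superset)
  show "{n. smult (fps_nth g n) (op_apply (T ^ n) p) \<noteq> 0} \<subseteq> {..<N}"
    using op_apply_power_eq_0_mono[OF assms] by (auto simp: not_less[symmetric])
qed simp

lemma op_apply_fps_op:
  assumes "locally_nilpotent T"
  shows "op_apply (fps_op g T) p = (\<Sum>n. smult (fps_nth g n) (op_apply (T ^ n) p))"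
proof -
  let ?F = "\<lambda>p. \<Sum>n. smult (fps_nth g n) (op_apply (T ^ n) p)"
  have "Vector_Spaces.linear smult smult ?F"
    unfolding linear_smult_iff
  proof (intro conjI allI)
    fix p q
    obtain M N where MN: "op_apply (T ^ M) p = 0" "op_apply (T ^ N) q = 0"
      using assms by (meson locally_nilpotent_def)
    let ?K = "max M N"
    have "op_apply (T ^ ?K) p = 0" "op_apply (T ^ ?K) q = 0"
      using MN op_apply_power_eq_0_mono by (meson max.cobounded1 max.cobounded2)+
    moreover from this have "op_apply (T ^ ?K) (p + q) = 0"
      by simp
    ultimately have "?F p = (\<Sum>n<?K. smult (fps_nth g n) (op_apply (T ^ n) p))"
      "?F q = (\<Sum>n<?K. smult (fps_nth g n) (op_apply (T ^ n) q))"
      "?F (p + q) = (\<Sum>n<?K. smult (fps_nth g n) (op_apply (T ^ n) (p + q)))"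
      by (simp_all only: Sum_any_power_eq_sum)
    then show "?F (p + q) = ?F p + ?F q"
      by (simp only: op_apply_add smult_add_right sum.distrib)
  next
    fix c p
    obtain N where "op_apply (T ^ N) p = 0"
      using assms by (meson locally_nilpotent_def)
    moreover from this have "op_apply (T ^ N) (smult c p) = 0"
      by simp
    ultimately have "?F p = (\<Sum>n<N. smult (fps_nth g n) (op_apply (T ^ n) p))"
      "?F (smult c p) = (\<Sum>n<N. smult (fps_nth g n) (op_apply (T ^ n) (smult c p)))"
      by (simp_all only: Sum_any_power_eq_sum)
    then show "?F (smult c p) = smult c (?F p)"
      by (simp only: op_apply_smult smult_sum smult_smult mult.commute)
  qed
  then show ?thesis
    by (simp add: fps_op_def Abs_poly_op_inverse)
qed

lemma op_apply_fps_op_eq_sum: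
  assumes "locally_nilpotent T" "op_apply (T ^ N) p = 0"
  shows "op_apply (fps_op g T) p = (\<Sum>n<N. smult (fps_nth g n) (op_apply (T ^ n) p))"
  using assms by (simp add: op_apply_fps_op Sum_any_power_eq_sum)

lemma op_apply_power_fps_op:
  assumes "locally_nilpotent T" "op_apply (T ^ N) p = 0"
  shows "op_apply (T ^ m) (op_apply (fps_op g T) p) =
         (\<Sum>n<N. smult (fps_nth g n) (op_apply (T ^ (m + n)) p))"
  using assms
  by (simp add: op_apply_fps_op_eq_sum op_apply_sum power_add times_poly_op.rep_eq)

lemma fps_op_commute:
  assumes "locally_nilpotent T"
  shows "fps_op g T * fps_op h T = fps_op h T * fps_op g T"
proof (rule poly_op_eqI)
  fix p
  obtain N where N: "op_apply (T ^ N) p = 0"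
    using assms by (meson locally_nilpotent_def)
  have *: "op_apply (fps_op g T * fps_op h T) p =
      (\<Sum>i<N. \<Sum>j<N. smult (fps_nth g i * fps_nth h j) (op_apply (T ^ (i + j)) p))" for g h
  proof -
    have "op_apply (T ^ N) (op_apply (fps_op h T) p) = 0"
      using N op_apply_power_eq_0_mono[OF N]
      by (simp add: op_apply_power_fps_op[OF assms N])
    then show ?thesis
      by (simp add: times_poly_op.rep_eq op_apply_fps_op_eq_sum[OF assms, of N "op_apply _ p"]
          op_apply_power_fps_op[OF assms N] smult_sum)
  qed
  show "op_apply (fps_op g T * fps_op h T) p = op_apply (fps_op h T * fps_op g T) p"
    unfolding * by (subst sum.swap) (simp add: mult.commute add.commute)
qed

lemma locally_nilpotent_fps_op:
  assumes "locally_nilpotent T" "fps_nth g 0 = 0"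
  shows "locally_nilpotent (fps_op g T)"
proof -
  have "op_apply (fps_op g T ^ N) p = 0" if "op_apply (T ^ N) p = 0" for N p
    using that
  proof (induction N arbitrary: p)
    case (Suc N)
    have "smult (fps_nth g n) (op_apply (T ^ (N + n)) p) = 0" for n
      using assms(2) op_apply_power_eq_0_mono[OF Suc.prems, of "N + n"] by (cases n) simp_all
    then have "op_apply (T ^ N) (op_apply (fps_op g T) p) = 0"
      by (simp only: op_apply_power_fps_op[OF assms(1) Suc.prems] sum.neutral_const)
    then show ?case
      using Suc.IH by (simp add: power_Suc2 times_poly_op.rep_eq del: power_Suc)
  qed simp
  then show ?thesis
    using assms(1) unfolding locally_nilpotent_def by meson
qed

lemma locally_nilpotent_op_D: "locally_nilpotent op_D"
proof -
  have "op_apply (op_D ^ n) p = 0" if "degree p < n" for n and p :: "complex poly"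
    using that
  proof (induction n arbitrary: p)
    case (Suc n)
    show ?case
    proof (cases "degree p = 0")
      case True
      then have "op_apply op_D p = 0"
        by (simp add: op_D.rep_eq pderiv_eq_0_iff)
      then show ?thesis
        by (simp add: power_Suc2 times_poly_op.rep_eq del: power_Suc)
    next
      case False
      then have "degree (pderiv p) < n"
        using Suc.prems by (simp add: degree_pderiv)
      then show ?thesis
        using Suc.IH by (simp add: power_Suc2 times_poly_op.rep_eq op_D.rep_eq del: power_Suc)
    qed
  qed simp
  then show ?thesis
    unfolding locally_nilpotent_def by blast
qed


section \<open>Umbral operators\<close>

text \<open>The series \<open>e\<^bsup>xf(t)\<^esup>\<close> in \<open>t\<close> with coefficients in \<open>\<complex>[x]\<close>: the exponential series
  \<open>\<Sum>z\<^sup>k/k!\<close> composed with \<open>x f(t)\<close>, whose constant term vanishes when \<open>f(0) = 0\<close>.\<close>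

definition exp_x_fps :: "complex fps \<Rightarrow> complex poly fps" where
  "exp_x_fps f =
     Abs_fps (\<lambda>k. [:1 / fact k:]) oo (fps_const [:0, 1:] * Abs_fps (\<lambda>j. [:fps_nth f j:]))"

definition umbral_poly :: "complex fps \<Rightarrow> nat \<Rightarrow> complex poly" where
  "umbral_poly f n = smult (fact n) (fps_nth (exp_x_fps f) n)"

lemma exp_x_fps_eq: "exp_x_fps f = Abs_fps (\<lambda>n. smult (1 / fact n) (umbral_poly f n))"
  by (simp add: fps_eq_iff umbral_poly_def)

lift_definition umbral_op :: "complex fps \<Rightarrow> poly_op"
  is "\<lambda>f p. \<Sum>i\<le>degree p. smult (coeff p i) (umbral_poly f i)"
proof -
  fix f
  let ?S = "\<lambda>N p. \<Sum>i\<le>N. smult (coeff p i) (umbral_poly f i)"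
  have S: "?S (degree p) p = ?S N p" if "degree p \<le> N" for N p
    using that by (intro sum.mono_neutral_left) (auto simp: coeff_eq_0)
  show "Vector_Spaces.linear smult smult (\<lambda>p. ?S (degree p) p)"
    unfolding linear_smult_iff
  proof (intro conjI allI)
    fix p q :: "complex poly"
    let ?N = "max (degree p) (degree q)"
    have "?S (degree (p + q)) (p + q) = ?S ?N (p + q)"
      by (rule S) (rule degree_add_le_max)
    also have "\<dots> = ?S ?N p + ?S ?N q"
      by (simp add: smult_add_left sum.distrib)
    finally show "?S (degree (p + q)) (p + q) = ?S (degree p) p + ?S (degree q) q"
      using S[of p ?N] S[of q ?N] by simp
  next
    fix c and p :: "complex poly"
    have "?S (degree (smult c p)) (smult c p) = ?S (degree p) (smult c p)"
      by (rule S) (rule degree_smult_le)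
    then show "?S (degree (smult c p)) (smult c p) = smult c (?S (degree p) p)"
      by (simp add: smult_sum)
  qed
qed

lemma umbral_op_monom: "op_apply (umbral_op f) (monom 1 n) = umbral_poly f n"
proof -
  have "op_apply (umbral_op f) (monom 1 n) =
        (\<Sum>i\<le>n. if i = n then umbral_poly f i else 0)"
    by (simp only: umbral_op.rep_eq degree_monom_eq[OF one_neq_zero]) (rule sum.cong, auto)
  then show ?thesis by simp
qed

definition delta_op :: "complex fps \<Rightarrow> poly_op" where
  "delta_op f = fps_op (fps_inv f) op_D"

lemma locally_nilpotent_delta_op: "locally_nilpotent (delta_op f)"
  unfolding delta_op_def
  by (rule locally_nilpotent_fps_op) (simp_all add: locally_nilpotent_op_D fps_inv_def)


section \<open>Partial exponential Bell polynomials\<close>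

text \<open>\<open>bell_poly n k y\<close> is the value of \<open>B\<^bsub>n,k\<^esub>\<close> at \<open>y 1, \<dots>, y (n - k + 1)\<close>, read off from the
  generating function \<open>1/k! (\<Sum>\<^bsub>j\<ge>1\<^esub> y\<^sub>j t\<^sup>j/j!)\<^sup>k = \<Sum> B\<^bsub>n,k\<^esub> t\<^sup>n/n!\<close>. The algebra may be
  noncommutative; the definition is meant for pairwise commuting \<open>y\<close> (see \<open>fps_op_commute\<close>), for
  which the coefficients do not depend on the order of the factors.\<close>

definition bell_poly :: "nat \<Rightarrow> nat \<Rightarrow> (nat \<Rightarrow> 'a::real_algebra_1) \<Rightarrow> 'a" where
  "bell_poly n k y =
     (fact n / fact k) *\<^sub>R
       fps_nth (Abs_fps (\<lambda>j. if j = 0 then 0 else (1 / fact j) *\<^sub>R y j) ^ k) n"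

lemma bell_poly_cong:
  fixes y z :: "nat \<Rightarrow> 'a::real_algebra_1"
  assumes "\<And>j. 1 \<le> j \<Longrightarrow> j \<le> n + 1 - k \<Longrightarrow> y j = z j"
  shows "bell_poly n k y = bell_poly n k z"
proof -
  define G where "G y = Abs_fps (\<lambda>j. if j = 0 then 0 else (1 / fact j) *\<^sub>R y j)"
    for y :: "nat \<Rightarrow> 'a"
  have G0: "fps_nth (G y ^ k) i = 0" if "i < k" for y i k
    using that by (intro startsby_zero_power_prefix[rule_format]) (auto simp: G_def)
  have "fps_nth (G y ^ k) n = fps_nth (G z ^ k) n"
    using assms
  proof (induction k arbitrary: n)
    case (Suc k)
    have "fps_nth (G y) i * fps_nth (G y ^ k) (n - i) =
          fps_nth (G z) i * fps_nth (G z ^ k) (n - i)" if "i \<le> n" for i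
    proof (cases "i = 0 \<or> n - i < k")
      case True
      then show ?thesis by (auto simp: G0) (simp_all add: G_def)
    next
      case False
      then have "fps_nth (G y) i = fps_nth (G z) i"
        by (cases "i \<le> n - k"; use Suc.prems[of i] that in \<open>auto simp: G_def\<close>)
      moreover have "fps_nth (G y ^ k) (n - i) = fps_nth (G z ^ k) (n - i)"
        using False that by (intro Suc.IH Suc.prems) auto
      ultimately show ?thesis by simp
    qed
    then show ?case by (simp add: fps_mult_nth)
  qed simp
  then show ?thesis by (simp add: bell_poly_def G_def)
qed

end

theory Submission
  imports Defs
begin

text \<open>Let \<open>E = e\<^bsup>xf(t)\<^esup> = \<Sum> \<phi>\<^sub>m t\<^sup>m/m!\<close>. An operator acting on the coefficients of \<open>E\<close> has symbol
  \<open>g(t)\<close> if it multiplies \<open>E\<close> by \<open>g(t)\<close>; symbols are additive and multiplicative. Since \<open>D\<close> has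
  symbol \<open>f\<close>, the operator \<open>Q = f\<^sup>-\<^sup>1(D)\<close> has symbol \<open>t\<close>, so \<open>B\<^bsub>n,k\<^esub>(f\<^sup>(\<^sup>1\<^sup>)(Q), \<dots>)\<close> has symbol
  \<open>B\<^bsub>n,k\<^esub>(f\<^sup>(\<^sup>1\<^sup>)(t), \<dots>)\<close>. The theorem, tested on \<open>x\<^sup>m\<close>, thereby becomes Faa di Bruno's formula
  \<open>\<partial>\<^sub>t\<^sup>n E = \<Sum>\<^sub>k x\<^sup>k B\<^bsub>n,k\<^esub>(f\<^sup>(\<^sup>1\<^sup>)(t), \<dots>) E\<close>.\<close>

section \<open>Symbols of operators\<close>

definition const_poly_fps :: "'a::comm_ring_1 fps \<Rightarrow> 'a poly fps" where
  "const_poly_fps g = Abs_fps (\<lambda>j. [:fps_nth g j:])"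

lemma const_poly_fps_nth [simp]: "fps_nth (const_poly_fps g) j = [:fps_nth g j:]"
  by (simp add: const_poly_fps_def)

lemma const_poly_fps_0 [simp]: "const_poly_fps 0 = 0"
  by (simp add: fps_eq_iff)

lemma const_poly_fps_1 [simp]: "const_poly_fps 1 = 1"
  by (simp add: fps_eq_iff one_pCons)

lemma const_poly_fps_add: "const_poly_fps (g + h) = const_poly_fps g + const_poly_fps h"
  by (simp add: fps_eq_iff)

lemma sum_pCons_0: "(\<Sum>i\<in>A. [:h i:]) = [:\<Sum>i\<in>A. h i:]"
  by (induction A rule: infinite_finite_induct) simp_all

lemma const_poly_fps_mult: "const_poly_fps (g * h) = const_poly_fps g * const_poly_fps h"
  by (simp add: fps_eq_iff fps_mult_nth sum_pCons_0 mult.commute)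

lemma const_poly_fps_power: "const_poly_fps (g ^ k) = const_poly_fps g ^ k"
  by (induction k) (simp_all add: const_poly_fps_mult)

lemma const_poly_fps_const: "const_poly_fps (fps_const c) = fps_const [:c:]"
  by (simp add: fps_eq_iff)

lemma const_poly_fps_deriv: "const_poly_fps (fps_deriv g) = fps_deriv (const_poly_fps g)"
  by (simp add: fps_eq_iff of_nat_poly)

definition has_symbol :: "complex poly fps \<Rightarrow> poly_op \<Rightarrow> complex fps \<Rightarrow> bool" where
  "has_symbol E T g \<longleftrightarrow> (\<forall>m. op_apply T (fps_nth E m) = fps_nth (const_poly_fps g * E) m)"

lemma has_symbol_0: "has_symbol E 0 0"
  by (simp add: has_symbol_def zero_poly_op.rep_eq)

lemma has_symbol_1: "has_symbol E 1 1"
  by (simp add: has_symbol_def one_poly_op.rep_eq)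

lemma has_symbol_add: "has_symbol E S g \<Longrightarrow> has_symbol E T h \<Longrightarrow> has_symbol E (S + T) (g + h)"
  by (simp add: has_symbol_def plus_poly_op.rep_eq const_poly_fps_add algebra_simps)

lemma has_symbol_sum:
  "(\<And>i. i \<in> A \<Longrightarrow> has_symbol E (S i) (g i)) \<Longrightarrow> has_symbol E (\<Sum>i\<in>A. S i) (\<Sum>i\<in>A. g i)"
  by (induction A rule: infinite_finite_induct) (simp_all add: has_symbol_0 has_symbol_add)

lemma has_symbol_scaleR:
  "has_symbol E T g \<Longrightarrow> has_symbol E (r *\<^sub>R T) (fps_const (complex_of_real r) * g)"
  by (simp add: has_symbol_def scaleR_poly_op.rep_eq const_poly_fps_mult const_poly_fps_const
      mult.assoc)

text \<open>\<open>T\<close> turns the coefficients of \<open>E\<close> into complex combinations of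
  themselves, through which the linear \<open>S\<close> passes. The multipliers arise in reverse
  order, which is harmless for power series.\<close>

lemma has_symbol_mult:
  assumes "has_symbol E S g" "has_symbol E T h"
  shows "has_symbol E (S * T) (g * h)"
  unfolding has_symbol_def
proof
  fix m
  have "op_apply (S * T) (fps_nth E m) =
      (\<Sum>i=0..m. smult (fps_nth h i) (op_apply S (fps_nth E (m - i))))"
    using assms(2) by (simp add: has_symbol_def times_poly_op.rep_eq fps_mult_nth op_apply_sum)
  also have "\<dots> = fps_nth (const_poly_fps h * (const_poly_fps g * E)) m"
    using assms(1) by (simp add: has_symbol_def fps_mult_nth)
  also have "\<dots> = fps_nth (const_poly_fps (g * h) * E) m"
    by (simp add: const_poly_fps_mult mult.commute mult.left_commute)
  finally show "op_apply (S * T) (fps_nth E m) = fps_nth (const_poly_fps (g * h) * E) m" .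
qed

lemma has_symbol_power: "has_symbol E T g \<Longrightarrow> has_symbol E (T ^ k) (g ^ k)"
  by (induction k) (simp_all add: has_symbol_1 has_symbol_mult)

text \<open>\<open>T ^ i\<close> has symbol \<open>s ^ i\<close>, of order at least i, so only i up
  to m affects the m-th coefficient: the operator series and the composition both become finite
  sums.\<close>

lemma has_symbol_fps_op:
  assumes "locally_nilpotent T" "has_symbol E T s" "fps_nth s 0 = 0"
  shows "has_symbol E (fps_op g T) (g oo s)"
  unfolding has_symbol_def
proof
  fix m
  have T: "op_apply (T ^ i) (fps_nth E m) =
      (\<Sum>j=0..m. smult (fps_nth (s ^ i) j) (fps_nth E (m - j)))" for i
    using has_symbol_power[OF assms(2), of i] by (simp add: has_symbol_def fps_mult_nth)
  have s: "fps_nth (s ^ i) j = 0" if "j < i" for i j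
    using startsby_zero_power_prefix[OF assms(3)] that by blast
  \<comment> \<open>One range of i serves every j, so that the sums over i and j can be
    interchanged.\<close>
  have comp: "fps_nth (g oo s) j = (\<Sum>i<Suc m. fps_nth g i * fps_nth (s ^ i) j)" if "j \<le> m" for j
    unfolding fps_compose_nth by (rule sum.mono_neutral_left) (use that s in auto)
  have "op_apply (T ^ Suc m) (fps_nth E m) = 0"
    unfolding T by (intro sum.neutral ballI) (auto simp: s simp del: power_Suc)
  then have "op_apply (fps_op g T) (fps_nth E m) =
      (\<Sum>i<Suc m. smult (fps_nth g i) (op_apply (T ^ i) (fps_nth E m)))"
    by (rule op_apply_fps_op_eq_sum[OF assms(1)])
  also have "\<dots> = (\<Sum>j=0..m. \<Sum>i<Suc m.
      smult (fps_nth g i * fps_nth (s ^ i) j) (fps_nth E (m - j)))"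
    unfolding T smult_sum smult_smult by (rule sum.swap)
  also have "\<dots> = fps_nth (const_poly_fps (g oo s) * E) m"
    unfolding fps_mult_nth
    by (rule sum.cong) (simp_all add: comp Polynomial.smult_sum del: sum.lessThan_Suc)
  finally show "op_apply (fps_op g T) (fps_nth E m) = fps_nth (const_poly_fps (g oo s) * E) m" .
qed


section \<open>Bell polynomials of power series\<close>

text \<open>The counterpart of \<open>bell_poly\<close> for power series, which do not form an instance of
  \<open>real_algebra_1\<close>.\<close>

definition bell_gen :: "(nat \<Rightarrow> 'a::field_char_0 fps) \<Rightarrow> 'a fps fps" where
  "bell_gen g = Abs_fps (\<lambda>j. if j = 0 then 0 else fps_const (1 / fact j) * g j)"

definition bell_fps :: "nat \<Rightarrow> nat \<Rightarrow> (nat \<Rightarrow> 'a::field_char_0 fps) \<Rightarrow> 'a fps" where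
  "bell_fps n k g = fps_const (fact n / fact k) * fps_nth (bell_gen g ^ k) n"

text \<open>Coefficients of powers of the generating series are built from sums and products, which
  symbols respect.\<close>

lemma has_symbol_bell_poly:
  assumes "\<And>j. has_symbol E (y j) (g j)"
  shows "has_symbol E (bell_poly n k y) (bell_fps n k g)"
proof -
  let ?Y = "Abs_fps (\<lambda>j. if j = 0 then 0 else (1 / fact j) *\<^sub>R y j)"
  have Y: "has_symbol E (fps_nth ?Y j) (fps_nth (bell_gen g) j)" for j
    using has_symbol_scaleR[OF assms, of "1 / fact j" j] by (simp add: bell_gen_def has_symbol_0)
  have "has_symbol E (fps_nth (?Y ^ k) n) (fps_nth (bell_gen g ^ k) n)" for n
  proof (induction k arbitrary: n)
    case 0
    show ?case by (simp add: has_symbol_0 has_symbol_1)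
  next
    case (Suc k)
    show ?case
      unfolding power_Suc fps_mult_nth by (intro has_symbol_sum has_symbol_mult Y Suc)
  qed
  from has_symbol_scaleR[OF this, of "fact n / fact k" n] show ?thesis
    by (simp add: bell_poly_def bell_fps_def)
qed

lemma bell_fps_0_right: "bell_fps n 0 g = (if n = 0 then 1 else 0)"
  by (simp add: bell_fps_def)

lemma bell_fps_eq_0: "n < k \<Longrightarrow> bell_fps n k g = 0"
  using startsby_zero_power_prefix[of "bell_gen g" k] by (simp add: bell_fps_def bell_gen_def)

text \<open>\<open>bell_gen\<close> of the derivatives of \<open>f\<close> is \<open>G(s, t) = f(s + t) - f(t)\<close>, so \<open>\<partial>\<^sub>s G = \<partial>\<^sub>t G + f'(t)\<close>;
  the lemma compares coefficients of \<open>s\<^sup>n\<close> in the resulting equation for \<open>G\<^sup>k\<close>.\<close>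

lemma bell_gen_power_Suc_nth:
  fixes f :: "'a::field_char_0 fps"
  defines "G \<equiv> bell_gen (\<lambda>j. fps_nth_deriv j f)"
  shows "of_nat (Suc n) * fps_nth (G ^ k) (Suc n) =
    fps_deriv (fps_nth (G ^ k) n) + of_nat k * fps_deriv f * fps_nth (G ^ (k - 1)) n"
proof -
  \<comment> \<open>\<open>dt\<close> differentiates in the inner variable t, whereas
    \<open>fps_deriv\<close> on the outer series differentiates in s.\<close>
  define dt :: "'a fps fps \<Rightarrow> 'a fps fps" where "dt H = Abs_fps (\<lambda>n. fps_deriv (fps_nth H n))" for H
  have dt_mult: "dt (H * K) = dt H * K + H * dt K" for H K
    by (rule fps_ext) (simp add: dt_def fps_mult_nth fps_deriv_sum sum.distrib add.commute)
  \<comment> \<open>At n = 0 the series \<open>dt G\<close> contributes nothing, since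
    \<open>G\<close> vanishes at s = 0; the added f' supplies that coefficient.\<close>
  have base: "fps_deriv G = dt G + fps_const (fps_deriv f)"
  proof (rule fps_ext)
    fix n
    have "of_nat (Suc n) * fps_const (1 / fact (Suc n)) = (fps_const (1 / fact n) :: 'a fps)"
      by (simp add: fps_of_nat[symmetric] del: of_nat_Suc)
    then show "fps_nth (fps_deriv G) n = fps_nth (dt G + fps_const (fps_deriv f)) n"
      by (cases "n = 0") (simp_all add: G_def bell_gen_def dt_def fps_nth_deriv_commute
          mult.assoc[symmetric] del: of_nat_Suc fact_Suc fps_nth_deriv.simps(2))
  qed
  have "fps_deriv (G ^ k) = dt (G ^ k) + of_nat k * fps_const (fps_deriv f) * G ^ (k - 1)"
  proof (induction k)
    case 0
    show ?case by (simp add: fps_eq_iff dt_def)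
  next
    case (Suc k)
    \<comment> \<open>Multiplying the last term of the induction hypothesis by \<open>G\<close>
      restores \<open>G ^ k\<close>, except at k = 0, where its factor k vanishes.\<close>
    have "k = 0 \<or> G * G ^ (k - Suc 0) = G ^ k"
      by (cases k) simp_all
    then show ?case
      using Suc.IH by (auto simp: base dt_mult algebra_simps)
  qed
  then have "fps_nth (fps_deriv (G ^ k)) n =
      fps_nth (dt (G ^ k) + of_nat k * fps_const (fps_deriv f) * G ^ (k - 1)) n"
    by simp
  then show ?thesis
    by (simp add: dt_def fps_of_nat[symmetric] mult.assoc)
qed

text \<open>Normalising the preceding coefficient identity by n!/(k+1)! absorbs its factor
  k+1.\<close>

lemma bell_fps_Suc_Suc:
  fixes f :: "'a::field_char_0 fps"
  defines "b \<equiv> \<lambda>n k. bell_fps n k (\<lambda>j. fps_nth_deriv j f)"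
  shows "b (Suc n) (Suc k) = fps_deriv (b n (Suc k)) + fps_deriv f * b n k"
proof -
  let ?G = "bell_gen (\<lambda>j. fps_nth_deriv j f)"
  let ?c = "fps_const (fact n / fact (Suc k)) :: 'a fps"
  have "fps_const (fact (Suc n) / fact (Suc k)) = ?c * of_nat (Suc n)"
    by (simp add: fps_of_nat[symmetric] del: of_nat_Suc)
  then have "b (Suc n) (Suc k) = ?c * (of_nat (Suc n) * fps_nth (?G ^ Suc k) (Suc n))"
    by (simp only: b_def bell_fps_def mult.assoc)
  also have "\<dots> = ?c * fps_deriv (fps_nth (?G ^ Suc k) n) +
      fps_deriv f * (?c * of_nat (Suc k) * fps_nth (?G ^ k) n)"
    by (simp only: bell_gen_power_Suc_nth diff_Suc_1 algebra_simps)
  also have "?c * of_nat (Suc k) = fps_const (fact n / fact k)"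
    by (simp add: fps_of_nat[symmetric] del: of_nat_Suc)
  also have "?c * fps_deriv (fps_nth (?G ^ Suc k) n) = fps_deriv (b n (Suc k))"
    by (simp add: b_def bell_fps_def del: power_Suc)
  finally show ?thesis
    by (simp add: b_def bell_fps_def)
qed


section \<open>The exponential generating function\<close>

lemma x_const_poly_fps_power_nth:
  "fps_nth ((fps_const [:0, 1:] * const_poly_fps f) ^ k) m = monom (fps_nth (f ^ k) m) k"
proof -
  have "(fps_const [:0, 1:] * const_poly_fps f) ^ k =
      fps_const (monom 1 k) * const_poly_fps (f ^ k)"
    by (simp add: power_mult_distrib const_poly_fps_power fps_const_power[symmetric] monom_altdef
        del: fps_const_power)
  then show ?thesis
    by (simp add: smult_monom mult.commute)
qed

text \<open>\<open>f ^ k\<close> has no coefficient at m for k > m, so the exponential may be cut at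
  any N \<ge> m; different coefficients can thus share one range of k.\<close>

lemma exp_x_fps_nth:
  assumes "fps_nth f 0 = 0" "m \<le> N"
  shows "fps_nth (exp_x_fps f) m = (\<Sum>k\<le>N. monom (fps_nth (f ^ k) m / fact k) k)"
proof -
  have "fps_nth (exp_x_fps f) m = (\<Sum>k=0..m. monom (fps_nth (f ^ k) m / fact k) k)"
    by (simp add: exp_x_fps_def fps_compose_nth const_poly_fps_def[symmetric]
        x_const_poly_fps_power_nth smult_monom)
  also have "\<dots> = (\<Sum>k\<le>N. monom (fps_nth (f ^ k) m / fact k) k)"
    by (rule sum.mono_neutral_left)
      (use assms startsby_zero_power_prefix[OF assms(1)] in \<open>auto simp: not_le\<close>)
  finally show ?thesis .
qed

text \<open>Term by term, d/dx takes x^k f^k / k! to f times x^(k-1) f^(k-1) / (k-1)!, and kills the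
  term k = 0.\<close>

lemma has_symbol_op_D:
  assumes "fps_nth f 0 = 0"
  shows "has_symbol (exp_x_fps f) op_D f"
  unfolding has_symbol_def
proof
  fix m
  have "op_apply op_D (fps_nth (exp_x_fps f) m) =
      (\<Sum>k\<le>Suc m. pderiv (monom (fps_nth (f ^ k) m / fact k) k))"
    by (simp only: exp_x_fps_nth[OF assms, of m "Suc m"] le_SucI order_refl op_apply_sum
        flip: op_D.rep_eq)
  also have "\<dots> = (\<Sum>k\<le>m. monom (fps_nth (f ^ Suc k) m / fact k) k)"
    by (subst sum.atMost_Suc_shift) (simp add: pderiv_monom del: power_Suc of_nat_Suc)
  also have "\<dots> = (\<Sum>k\<le>m. \<Sum>j=0..m. smult (fps_nth f j) (monom (fps_nth (f ^ k) (m - j) / fact k) k))"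
    by (simp add: fps_mult_nth sum_divide_distrib smult_monom monom_sum)
  also have "\<dots> = (\<Sum>j=0..m. smult (fps_nth f j) (\<Sum>k\<le>m. monom (fps_nth (f ^ k) (m - j) / fact k) k))"
    by (subst sum.swap) (simp add: smult_sum)
  also have "\<dots> = fps_nth (const_poly_fps f * exp_x_fps f) m"
    by (simp add: fps_mult_nth exp_x_fps_nth[OF assms, of _ m])
  finally show "op_apply op_D (fps_nth (exp_x_fps f) m) =
      fps_nth (const_poly_fps f * exp_x_fps f) m" .
qed

lemma has_symbol_delta_op:
  assumes "fps_nth f 0 = 0" "fps_nth f 1 \<noteq> 0"
  shows "has_symbol (exp_x_fps f) (delta_op f) fps_X"
  using has_symbol_fps_op[OF locally_nilpotent_op_D has_symbol_op_D[OF assms(1)] assms(1),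
      of "fps_inv f"]
  by (simp add: delta_op_def fps_inv[OF assms])

text \<open>Chain rule in t: the outer exponential series is its own derivative, and x is
  constant.\<close>

lemma fps_deriv_exp_x_fps:
  assumes "fps_nth f 0 = 0"
  shows "fps_deriv (exp_x_fps f) =
    fps_const [:0, 1:] * const_poly_fps (fps_deriv f) * exp_x_fps f"
proof -
  let ?e = "Abs_fps (\<lambda>k. [:1 / fact k:]) :: complex poly fps"
  have "fps_deriv ?e = ?e"
    by (rule fps_ext) (simp add: of_nat_poly divide_simps del: of_nat_Suc)
  then show ?thesis
    using assms
    by (simp add: exp_x_fps_def const_poly_fps_def[symmetric] fps_compose_deriv
        const_poly_fps_deriv mult_ac)
qed

lemma fps_nth_deriv_exp_x_fps:
  assumes "fps_nth f 0 = 0"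
  shows "fps_nth_deriv n (exp_x_fps f) =
    (\<Sum>k=0..n. fps_const ([:0, 1:] ^ k) * const_poly_fps (bell_fps n k (\<lambda>j. fps_nth_deriv j f)))
      * exp_x_fps f"
proof (induction n)
  case 0
  show ?case by (simp add: bell_fps_0_right)
next
  case (Suc n)
  let ?E = "exp_x_fps f" and ?X = "fps_const [:0, 1:] :: complex poly fps"
  define b where "b n k = const_poly_fps (bell_fps n k (\<lambda>j. fps_nth_deriv j f))" for n k
  have b_Suc: "b (Suc n) (Suc k) = fps_deriv (b n (Suc k)) + const_poly_fps (fps_deriv f) * b n k"
    for k
    by (simp add: b_def bell_fps_Suc_Suc const_poly_fps_add const_poly_fps_mult const_poly_fps_deriv)
  have b_0: "fps_deriv (b n 0) = 0" "b (Suc n) 0 = 0"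
    by (simp_all add: b_def bell_fps_0_right)
  have b_top: "b n (Suc n) = 0"
    by (simp add: b_def bell_fps_eq_0)
  have "fps_nth_deriv (Suc n) ?E = fps_deriv ((\<Sum>k=0..n. ?X ^ k * b n k) * ?E)"
    by (simp only: fps_nth_deriv_commute Suc.IH b_def fps_const_power)
  also have "\<dots> = ((\<Sum>k=0..n. ?X ^ k * fps_deriv (b n k)) +
      (\<Sum>k=0..n. ?X ^ Suc k * (const_poly_fps (fps_deriv f) * b n k))) * ?E"
    by (simp add: fps_deriv_exp_x_fps[OF assms] fps_deriv_sum fps_const_power sum_distrib_left
        sum_distrib_right sum.distrib algebra_simps)
  \<comment> \<open>\<open>b n 0\<close> is constant in t and \<open>b n (Suc n)\<close> is zero, so
    the shift drops a zero at the bottom and adds one at the top, aligning the powers of x with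
    \<open>b_Suc\<close>.\<close>
  also have "(\<Sum>k=0..n. ?X ^ k * fps_deriv (b n k)) =
      (\<Sum>k=0..n. ?X ^ Suc k * fps_deriv (b n (Suc k)))"
  proof -
    have "(\<Sum>k=0..n. ?X ^ k * fps_deriv (b n k)) = (\<Sum>k=0..Suc n. ?X ^ k * fps_deriv (b n k))"
      by (simp add: b_top)
    also have "\<dots> = (\<Sum>k=0..n. ?X ^ Suc k * fps_deriv (b n (Suc k)))"
      by (subst sum.atLeast0_atMost_Suc_shift) (simp add: b_0)
    finally show ?thesis .
  qed
  also have "\<dots> + (\<Sum>k=0..n. ?X ^ Suc k * (const_poly_fps (fps_deriv f) * b n k)) =
      (\<Sum>k=0..n. ?X ^ Suc k * b (Suc n) (Suc k))"
    by (simp only: b_Suc distrib_left sum.distrib)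
  also have "\<dots> = (\<Sum>k=0..Suc n. ?X ^ k * b (Suc n) k)"
    by (subst sum.atLeast0_atMost_Suc_shift) (simp add: b_0)
  finally show ?case
    by (simp only: b_def fps_const_power)
qed

lemma fps_nth_deriv_nth:
  fixes a :: "'a::comm_semiring_1 fps"
  shows "of_nat (fact m) * fps_nth (fps_nth_deriv n a) m = of_nat (fact (m + n)) * fps_nth a (m + n)"
proof (induction n arbitrary: m)
  case (Suc n)
  have "of_nat (fact m) * fps_nth (fps_nth_deriv (Suc n) a) m =
      of_nat (fact (Suc m)) * fps_nth (fps_nth_deriv n a) (Suc m)"
    by (simp add: fps_nth_deriv_commute algebra_simps del: fps_nth_deriv.simps(2))
  then show ?case
    using Suc.IH[of "Suc m"] by simp
qed simp


section \<open>Expansion of the umbral operator\<close>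

lemma poly_op_eqI_monom:
  assumes "\<And>m. op_apply S (monom 1 m) = op_apply T (monom 1 m)"
  shows "S = T"
proof (rule poly_op_eqI)
  fix p :: "complex poly"
  have "p = (\<Sum>i\<le>degree p. smult (coeff p i) (monom 1 i))"
    by (simp add: smult_monom poly_as_sum_of_monoms)
  then show "op_apply S p = op_apply T p"
    by (metis (no_types, lifting) assms op_apply_smult op_apply_sum sum.cong)
qed

lemma op_apply_op_X_power: "op_apply (op_X ^ k) p = [:0, 1:] ^ k * p"
  by (induction k) (simp_all add: one_poly_op.rep_eq times_poly_op.rep_eq op_X.rep_eq mult.assoc)

theorem theorem1:
  fixes f :: "complex fps" and n :: nat
  assumes "fps_nth f 0 = 0" and "fps_nth f 1 \<noteq> 0"
  shows "umbral_op f * op_X ^ n =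
    (\<Sum>k=0..n. op_X ^ k * bell_poly n k (\<lambda>j. fps_op (fps_nth_deriv j f) (delta_op f)) * umbral_op f)"
proof (rule poly_op_eqI_monom)
  fix m
  let ?E = "exp_x_fps f"
  let ?B = "\<lambda>k. bell_poly n k (\<lambda>j. fps_op (fps_nth_deriv j f) (delta_op f))"
  let ?b = "\<lambda>k. bell_fps n k (\<lambda>j. fps_nth_deriv j f)"
  \<comment> \<open>Q has symbol t, so the composition to take is \<open>g oo fps_X\<close>, which
    is \<open>g\<close>.\<close>
  have "has_symbol ?E (fps_op g (delta_op f)) g" for g
    using has_symbol_fps_op[OF locally_nilpotent_delta_op has_symbol_delta_op[OF assms], of g]
    by simp
  then have B: "op_apply (?B k) (fps_nth ?E m) = fps_nth (const_poly_fps (?b k) * ?E) m" for k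
    using has_symbol_bell_poly unfolding has_symbol_def by (metis (no_types, lifting))
  have sum_apply: "op_apply (\<Sum>k\<in>A. h k) p = (\<Sum>k\<in>A. op_apply (h k) p)" for A :: "nat set" and h p
    by (induction A rule: infinite_finite_induct)
      (simp_all add: zero_poly_op.rep_eq plus_poly_op.rep_eq)
  have X_power: "[:0, 1:] ^ n = (monom 1 n :: complex poly)"
    by (simp add: monom_altdef)
  have "op_apply (umbral_op f * op_X ^ n) (monom 1 m) = umbral_poly f (m + n)"
    by (simp add: times_poly_op.rep_eq op_apply_op_X_power X_power mult_monom umbral_op_monom
        add.commute)
  also have "\<dots> = smult (fact m) (fps_nth (fps_nth_deriv n ?E) m)"
    using fps_nth_deriv_nth[of m n ?E] by (simp add: umbral_poly_def of_nat_poly)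
  also have "\<dots> = (\<Sum>k=0..n. smult (fact m)
      ([:0, 1:] ^ k * fps_nth (const_poly_fps (?b k) * ?E) m))"
    by (simp add: fps_nth_deriv_exp_x_fps[OF assms(1)] sum_distrib_right fps_sum_nth smult_sum
        mult.assoc)
  \<comment> \<open>By \<open>B\<close>, each summand contains \<open>?B k\<close> applied to the
    m-th coefficient of \<open>?E\<close>, and m! times that coefficient is the image of x^m under
    the umbral operator.\<close>
  also have "\<dots> = op_apply (\<Sum>k=0..n. op_X ^ k * ?B k * umbral_op f) (monom 1 m)"
    by (simp add: sum_apply times_poly_op.rep_eq op_apply_op_X_power umbral_op_monom
        umbral_poly_def B)
  finally show "op_apply (umbral_op f * op_X ^ n) (monom 1 m) =
      op_apply (\<Sum>k=0..n. op_X ^ k * ?B k * umbral_op f) (monom 1 m)" .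
qed

end
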